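(* Fix $\lambda>0$ and $\varepsilon>0$. Let $G_n\sim G(n,\lambda/n)$. Then there exists $\eta=\eta(\lambda,\varepsilon)>0$ such that $$\mathbb P\Bigl(\forall S\subset[n]\text{ with }|S|\le\eta n:\ e_{G_n}(S)\le(1+\varepsilon)|S|\Bigr)\xrightarrow[n\to\infty]{}1.$$
   Context: $[n]=\{1,\dots,n\}$. $G(n,\lambda/n)$ is the Erdős–Rényi random graph on $[n]$ in which each edge $\{i,j\}$, $i<j$, is present independently with probability $\lambda/n$. For a set $S$ of vertices, $e_G(S)$ is the number of edges of $G$ with both endpoints in $S$. *)

theory Defs
  imports "HOL-Probability.Probability"
begin

text \<open>A graph on \<open>{1..n}\<close> is represented by its edge set, a set of two-element sets \<open>{i, j}\<close>.\<close>

definition potential_edges :: "nat \<Rightarrow> nat set set" where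
  "potential_edges n = {{i, j} | i j. i \<in> {1..n} \<and> j \<in> {1..n} \<and> i < j}"

text \<open>\<open>bernoulli_pmf\<close> truncates its parameter to \<open>[0, 1]\<close>, so for
  \<open>p > 1\<close> this is the complete graph; with \<open>p = \<lambda> / n\<close> that concerns only the finitely
  many \<open>n < \<lambda>\<close>.\<close>

definition erdos_renyi :: "nat \<Rightarrow> real \<Rightarrow> nat set set pmf" where
  "erdos_renyi n p =
     map_pmf (\<lambda>present. {e \<in> potential_edges n. present e})
       (Pi_pmf (potential_edges n) False (\<lambda>_. bernoulli_pmf p))"

definition edges_inside :: "nat set set \<Rightarrow> nat set \<Rightarrow> nat" where
  "edges_inside G S = card {e \<in> G. e \<subseteq> S}"

end

theory Submission
  imports Defs
begin

text \<open>
  The proof is a first moment computation. If a set \<open>S\<close> of \<open>k \<ge> 1\<close> vertices spans more than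
  \<open>(1 + \<epsilon>) k\<close> edges, then some \<open>m = \<lceil>(1 + \<epsilon>) k\<rceil>\<close> of the pairs inside \<open>S\<close> are all present.
  There are \<open>n choose k\<close> choices for \<open>S\<close> and at most \<open>k\<^sup>2 choose m\<close> for the pairs, and each choice
  has probability \<open>(\<lambda> / n) ^ m\<close> (lemma \<open>prob_exists_dense_set_le\<close>). With
  \<open>N choose j \<le> (e N / j) ^ j\<close> and \<open>m \<ge> k\<close>, the product of the three factors is at most
  \[ (e n / k)^k \, (e \lambda k / n)^m. \]
  When \<open>e \<lambda> k / n \<le> 1\<close>, the exponent \<open>m\<close> may be lowered to \<open>(1 + \<epsilon>) k\<close>. One power of \<open>k / n\<close> then
  cancels against the number of choices of \<open>S\<close>, and the excess \<open>\<epsilon>\<close> leaves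
  \[ \bigl(C \, (k / n)^\varepsilon\bigr)^k, \qquad C = e \, (e \lambda)^{1 + \varepsilon} \]
  (lemma \<open>dense_set_count_le\<close>).

  Now choose \<open>\<eta>\<close> with \<open>e \<lambda> \<eta> \<le> 1\<close> and \<open>C \<eta>\<^sup>\<epsilon> \<le> 1/2\<close>. For \<open>k \<le> \<eta> n\<close> the \<open>k\<close>-th term is at most
  \<open>2\<^sup>-\<^sup>k\<close>, uniformly in \<open>n\<close>, and it tends to \<open>0\<close> for each fixed \<open>k\<close> as \<open>n\<close> grows.
  Tannery's theorem (dominated convergence for series) shows that the sum over \<open>k\<close> tends to \<open>0\<close>
  (lemma \<open>truncated_power_sum_tendsto_0\<close>).
\<close>

section \<open>Binomial estimates\<close>

lemma power_le_fact_mult_exp: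
  fixes x :: real
  assumes "x \<ge> 0"
  shows "x ^ k \<le> fact k * exp x"
proof -
  have "(\<Sum>i\<in>{k}. x ^ i /\<^sub>R fact i) \<le> (\<Sum>i. x ^ i /\<^sub>R fact i)"
    using assms by (intro sum_le_suminf sums_summable[OF exp_converges]) auto
  also have "\<dots> = exp x"
    using sums_unique[OF exp_converges[of x]] by simp
  finally have "x ^ k /\<^sub>R fact k \<le> exp x" by simp
  then show ?thesis by (simp add: field_simps)
qed

lemma binomial_le_exp_power:
  assumes "k > 0"
  shows "real (n choose k) \<le> (exp 1 * real n / real k) ^ k"
proof -
  have "real (n choose k) * real k ^ k \<le> real (n choose k) * (fact k * exp (real k))"
    by (intro mult_left_mono power_le_fact_mult_exp) auto
  also have "\<dots> = real ((n choose k) * fact k) * exp (real k)"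
    by simp
  also have "\<dots> \<le> real (n ^ k) * exp (real k)"
    by (intro mult_right_mono of_nat_mono binomial_fact_pow) auto
  also have "\<dots> = (exp 1 * real n) ^ k"
    by (simp add: power_mult_distrib exp_of_nat_mult[symmetric])
  finally show ?thesis
    using assms by (simp add: power_divide field_simps)
qed

text \<open>
  The first moment bound for vertex sets of size \<open>k\<close>. The bound \<open>m \<ge> k\<close> turns
  \<open>k\<^sup>2 choose m\<close> into \<open>(e k) ^ m\<close>, and \<open>e \<lambda> k / n \<le> 1\<close> allows replacing the integer
  exponent \<open>m\<close> by the real exponent \<open>(1 + \<epsilon>) k\<close>.
\<close>

lemma dense_set_count_le:
  fixes lam eps :: real
  assumes "lam > 0" "eps > 0" "k > 0" "n > 0"
    and m: "(1 + eps) * real k \<le> real m"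
    and small: "exp 1 * lam * (real k / real n) \<le> 1"
  shows "real (n choose k) * (real (k\<^sup>2 choose m) * (lam / real n) ^ m)
          \<le> (exp 1 * (exp 1 * lam) powr (1 + eps) * (real k / real n) powr eps) ^ k"
proof -
  define q where "q = real k / real n"
  have q: "q > 0" using assms by (simp add: q_def)
  have "real k \<le> (1 + eps) * real k" using assms by simp
  with m have km: "k \<le> m" by linarith
  have "real (k\<^sup>2 choose m) \<le> (exp 1 * real (k\<^sup>2) / real m) ^ m"
    using assms km by (intro binomial_le_exp_power) auto
  also have "\<dots> \<le> (exp 1 * real k) ^ m"
    using assms km by (intro power_mono) (auto simp: field_simps power2_eq_square)
  finally have "real (k\<^sup>2 choose m) * (lam / real n) ^ m \<le> (exp 1 * real k) ^ m * (lam / real n) ^ m"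
    using assms by (intro mult_right_mono) auto
  also have "\<dots> = (exp 1 * lam * q) ^ m"
    by (simp add: q_def power_mult_distrib power_divide)
  also have "\<dots> = (exp 1 * lam * q) powr real m"
    using assms q by (simp add: powr_realpow)
  also have "\<dots> \<le> (exp 1 * lam * q) powr ((1 + eps) * real k)"
    using assms q by (intro powr_mono') (auto simp: q_def)
  also have "\<dots> = ((exp 1 * lam * q) powr (1 + eps)) ^ k"
    using assms q by (simp add: powr_powr[symmetric] powr_realpow)
  finally have edges: "real (k\<^sup>2 choose m) * (lam / real n) ^ m
                        \<le> ((exp 1 * lam * q) powr (1 + eps)) ^ k" .
  have sets: "real (n choose k) \<le> (exp 1 / q) ^ k"
    using binomial_le_exp_power[of k n] assms by (simp add: q_def)
  have "real (n choose k) * (real (k\<^sup>2 choose m) * (lam / real n) ^ m)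
          \<le> (exp 1 / q) ^ k * ((exp 1 * lam * q) powr (1 + eps)) ^ k"
    using assms q by (intro mult_mono sets edges) auto
  also have "\<dots> = (exp 1 / q * (exp 1 * lam * q) powr (1 + eps)) ^ k"
    by (rule power_mult_distrib[symmetric])
  also have "exp 1 / q * (exp 1 * lam * q) powr (1 + eps)
               = exp 1 * (exp 1 * lam) powr (1 + eps) * q powr eps"
    using assms q by (simp add: powr_mult powr_add[of q])
  finally show ?thesis by (simp add: q_def)
qed

section \<open>Dense vertex sets in the random graph\<close>

lemma finite_potential_edges: "finite (potential_edges n)"
  by (rule finite_subset[of _ "Pow {1..n}"]) (auto simp: potential_edges_def)

lemma set_pmf_erdos_renyi_subset: "G \<in> set_pmf (erdos_renyi n p) \<Longrightarrow> G \<subseteq> potential_edges n"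
  by (auto simp: erdos_renyi_def)

lemma prob_edges_present:
  assumes "T \<subseteq> potential_edges n" "0 \<le> p" "p \<le> 1"
  shows "measure_pmf.prob (erdos_renyi n p) {G. T \<subseteq> G} = p ^ card T"
proof -
  let ?E = "potential_edges n" and ?B = "\<lambda>e. if e \<in> T then {True} else UNIV"
  have "measure_pmf.prob (erdos_renyi n p) {G. T \<subseteq> G} =
        measure_pmf.prob (Pi_pmf ?E False (\<lambda>_. bernoulli_pmf p)) (Pi ?E ?B)"
    unfolding erdos_renyi_def measure_map_pmf
    using assms by (intro arg_cong2[where f = measure] refl) (auto simp: Pi_iff split: if_splits)
  also have "\<dots> = (\<Prod>e\<in>?E. measure_pmf.prob (bernoulli_pmf p) (?B e))"
    by (rule measure_Pi_pmf_Pi[OF finite_potential_edges])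
  also have "\<dots> = (\<Prod>e\<in>?E. if e \<in> T then p else 1)"
    using assms by (intro prod.cong refl) (auto simp: measure_pmf_single)
  also have "\<dots> = p ^ card T"
    using assms finite_potential_edges[of n]
    by (simp add: prod.If_cases Int_absorb1 Int_absorb2 flip: Int_def)
  finally show ?thesis .
qed

text \<open>
  Counting ordered pairs costs a factor of about \<open>2\<close> against the exact \<open>card S choose 2\<close>; in the
  first moment bound this only changes constants.
\<close>

lemma card_potential_edges_inside_le:
  assumes "finite S"
  shows "card {e \<in> potential_edges n. e \<subseteq> S} \<le> (card S)\<^sup>2"
proof -
  have "{e \<in> potential_edges n. e \<subseteq> S} \<subseteq> (\<lambda>(i, j). {i, j}) ` (S \<times> S)"
    by (auto simp: potential_edges_def)
  then have "card {e \<in> potential_edges n. e \<subseteq> S} \<le> card (S \<times> S)"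
    using assms by (meson card_image_le card_mono finite_SigmaI finite_imageI order_trans)
  then show ?thesis by (simp add: card_cartesian_product power2_eq_square)
qed

text \<open>
  Union bound over the \<open>m\<close>-element sets of pairs inside \<open>S\<close>. The graph is first restricted to the
  support of the distribution, since outside it \<open>edges_inside\<close> could count sets that are not
  potential edges.
\<close>

lemma prob_dense_set_le:
  assumes "finite S" "0 \<le> p" "p \<le> 1"
  shows "measure_pmf.prob (erdos_renyi n p) {G. m \<le> edges_inside G S}
          \<le> real ((card S)\<^sup>2 choose m) * p ^ m"
proof -
  let ?P = "measure_pmf.prob (erdos_renyi n p)"
  define E where "E = {e \<in> potential_edges n. e \<subseteq> S}"
  define W where "W = {T. T \<subseteq> E \<and> card T = m}"
  have finE: "finite E" using finite_potential_edges by (simp add: E_def)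
  have "?P {G. m \<le> edges_inside G S} = ?P ({G. m \<le> edges_inside G S} \<inter> set_pmf (erdos_renyi n p))"
    by (simp add: measure_Int_set_pmf)
  also have "\<dots> \<le> ?P (\<Union>T\<in>W. {G. T \<subseteq> G})"
  proof (intro measure_pmf.finite_measure_mono subsetI)
    fix G assume G: "G \<in> {G. m \<le> edges_inside G S} \<inter> set_pmf (erdos_renyi n p)"
    then obtain T where "T \<subseteq> {e \<in> G. e \<subseteq> S}" "card T = m"
      by (auto simp: edges_inside_def intro: obtain_subset_with_card_n)
    then show "G \<in> (\<Union>T\<in>W. {G. T \<subseteq> G})"
      using G set_pmf_erdos_renyi_subset[of G n p] by (auto simp: W_def E_def)
  qed auto
  also have "\<dots> \<le> (\<Sum>T\<in>W. ?P {G. T \<subseteq> G})"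
    using finE by (intro measure_UNION_le) (auto simp: W_def)
  also have "\<dots> = (\<Sum>T\<in>W. p ^ m)"
    using assms by (intro sum.cong refl) (subst prob_edges_present, auto simp: W_def E_def)
  also have "\<dots> = real (card E choose m) * p ^ m"
    using n_subsets[OF finE, of m] by (simp add: W_def)
  also have "\<dots> \<le> real ((card S)\<^sup>2 choose m) * p ^ m"
    using card_potential_edges_inside_le[OF assms(1), of n] assms
    by (intro mult_right_mono of_nat_mono binomial_right_mono) (auto simp: E_def)
  finally show ?thesis .
qed

lemma prob_exists_dense_set_le:
  assumes "0 \<le> p" "p \<le> 1"
  shows "measure_pmf.prob (erdos_renyi n p)
            {G. \<exists>S. S \<subseteq> {1..n} \<and> card S = k \<and> m \<le> edges_inside G S}
          \<le> real (n choose k) * (real (k\<^sup>2 choose m) * p ^ m)"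
proof -
  let ?P = "measure_pmf.prob (erdos_renyi n p)"
  define W where "W = {S. S \<subseteq> {1..n} \<and> card S = k}"
  have "{G. \<exists>S. S \<subseteq> {1..n} \<and> card S = k \<and> m \<le> edges_inside G S}
          = (\<Union>S\<in>W. {G. m \<le> edges_inside G S})"
    by (auto simp: W_def)
  also have "?P \<dots> \<le> (\<Sum>S\<in>W. ?P {G. m \<le> edges_inside G S})"
    by (intro measure_UNION_le) (auto simp: W_def)
  also have "\<dots> \<le> (\<Sum>S\<in>W. real (k\<^sup>2 choose m) * p ^ m)"
  proof (rule sum_mono)
    fix S assume "S \<in> W"
    then have "finite S" "card S = k" by (auto simp: W_def intro: finite_subset)
    then show "?P {G. m \<le> edges_inside G S} \<le> real (k\<^sup>2 choose m) * p ^ m"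
      using prob_dense_set_le[of S p n m] assms by simp
  qed
  also have "\<dots> = real (n choose k) * (real (k\<^sup>2 choose m) * p ^ m)"
    using n_subsets[of "{1..n}" k] by (simp add: W_def)
  finally show ?thesis .
qed

section \<open>Summing over the sizes of the vertex sets\<close>

text \<open>
  Every term is dominated by \<open>2\<^sup>-\<^sup>k\<close> because \<open>C (k / n)\<^sup>\<epsilon> \<le> C \<eta>\<^sup>\<epsilon> \<le> 1/2\<close>, while a single term tends
  to \<open>0\<close> because its base does: this is where \<open>\<epsilon> > 0\<close> and \<open>k \<ge> 1\<close> enter.
\<close>

lemma truncated_power_sum_tendsto_0:
  fixes C eps eta :: real
  assumes "C \<ge> 0" "eps > 0" "C * eta powr eps \<le> 1 / 2"
  shows "(\<lambda>n::nat. \<Sum>k | 0 < k \<and> real k \<le> eta * real n. (C * (real k / real n) powr eps) ^ k)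
           \<longlonglongrightarrow> 0"
proof -
  define a where "a = (\<lambda>k n. if 0 < k \<and> real k \<le> eta * real n
                             then (C * (real k / real n) powr eps) ^ k else 0)"
  have lim: "(\<lambda>n. a k n) \<longlonglongrightarrow> 0" for k
  proof (cases "k = 0")
    case True
    then show ?thesis by (simp add: a_def)
  next
    case False
    have "(\<lambda>n. real k / real n) \<longlonglongrightarrow> 0"
      by (rule lim_const_over_n)
    then have "(\<lambda>n. (real k / real n) powr eps) \<longlonglongrightarrow> 0"
      using assms by (intro tendsto_zero_powrI[where b = eps]) auto
    then have "(\<lambda>n. (C * (real k / real n) powr eps) ^ k) \<longlonglongrightarrow> (C * 0) ^ k"
      by (intro tendsto_power tendsto_mult tendsto_const)
    then have "(\<lambda>n. (C * (real k / real n) powr eps) ^ k) \<longlonglongrightarrow> 0"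
      using False by (simp only: mult_zero_right power_0_left if_False)
    then show ?thesis
      by (rule Lim_null_comparison[rotated]) (use assms in \<open>auto simp: a_def\<close>)
  qed
  have bound: "norm (a k n) \<le> (1 / 2) ^ k" for k n
  proof (cases "0 < k \<and> real k \<le> eta * real n")
    case True
    then have "n > 0" by (cases n) auto
    then have "C * (real k / real n) powr eps \<le> C * eta powr eps"
      using True assms by (intro mult_left_mono powr_mono2) (auto simp: field_simps)
    also have "\<dots> \<le> 1 / 2" by fact
    finally have "(C * (real k / real n) powr eps) ^ k \<le> (1 / 2) ^ k"
      using assms by (intro power_mono) auto
    then show ?thesis using True assms by (simp add: a_def)
  qed (auto simp: a_def)
  have "(\<lambda>n. \<Sum>k. a k n) \<longlonglongrightarrow> (\<Sum>k. 0)"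
  proof (intro tannerys_theorem[THEN conjunct2, THEN conjunct2])
    show "\<forall>\<^sub>F (k, n) in sequentially \<times>\<^sub>F sequentially. norm (a k n) \<le> (1 / 2) ^ k"
      using bound by (intro always_eventually) auto
  qed (use lim in \<open>auto simp: summable_geometric\<close>)
  moreover have "(\<Sum>k. a k n)
      = (\<Sum>k | 0 < k \<and> real k \<le> eta * real n. (C * (real k / real n) powr eps) ^ k)" for n
  proof -
    have fin: "finite {k. 0 < k \<and> real k \<le> eta * real n}"
      by (rule finite_subset[of _ "{..nat \<lfloor>eta * real n\<rfloor>}"]) (auto simp: le_nat_floor)
    have "(\<Sum>k. a k n) = (\<Sum>k | 0 < k \<and> real k \<le> eta * real n. a k n)"
      by (intro suminf_finite fin) (auto simp: a_def)
    then show ?thesis by (simp add: a_def)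
  qed
  ultimately show ?thesis by simp
qed

theorem lemma4p1:
  fixes lam eps :: real
  assumes "lam > 0" and "eps > 0"
  shows "\<exists>eta::real. eta > 0 \<and>
    (\<lambda>n::nat. measure_pmf.prob (erdos_renyi n (lam / real n))
        {G. \<forall>S. S \<subseteq> {1..n} \<and> real (card S) \<le> eta * real n \<longrightarrow>
              real (edges_inside G S) \<le> (1 + eps) * real (card S)})
      \<longlonglongrightarrow> 1"
proof -
  define C where "C = exp 1 * (exp 1 * lam) powr (1 + eps)"
  \<comment> \<open>The first entry gives \<open>e \<lambda> \<eta> \<le> 1\<close>, and the second solves \<open>C \<eta>\<^sup>\<epsilon> = 1/2\<close>.\<close>
  define eta where "eta = min (1 / (exp 1 * lam)) ((1 / (2 * C)) powr (1 / eps))"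
  have C: "C > 0" using assms by (simp add: C_def)
  have eta: "eta > 0" using assms C by (simp add: eta_def)
  have "eta powr eps \<le> ((1 / (2 * C)) powr (1 / eps)) powr eps"
    using assms eta by (intro powr_mono2) (auto simp: eta_def)
  also have "\<dots> = 1 / (2 * C)" using assms C by (simp add: powr_powr)
  finally have Ceta: "C * eta powr eps \<le> 1 / 2" using C by (simp add: field_simps)
  have lameta: "exp 1 * lam * eta \<le> 1"
  proof -
    have "exp 1 * lam * eta \<le> exp 1 * lam * (1 / (exp 1 * lam))"
      using assms by (intro mult_left_mono) (auto simp: eta_def)
    then show ?thesis using assms by simp
  qed

  define P where "P = (\<lambda>n. measure_pmf.prob (erdos_renyi n (lam / real n)))"
  define good where "good = (\<lambda>n. {G. \<forall>S. S \<subseteq> {1..n} \<and> real (card S) \<le> eta * real n \<longrightarrow>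
              real (edges_inside G S) \<le> (1 + eps) * real (card S)})"
  define K where "K = (\<lambda>n. {k. 0 < k \<and> real k \<le> eta * real n})"
  define m where "m = (\<lambda>k. nat \<lceil>(1 + eps) * real k\<rceil>)"
  define B where "B = (\<lambda>n k. {G. \<exists>S. S \<subseteq> {1..n} \<and> card S = k \<and> m k \<le> edges_inside G S})"
  define s where "s = (\<lambda>n. \<Sum>k\<in>K n. (C * (real k / real n) powr eps) ^ k)"

  have bad_le: "P n (- good n) \<le> s n" if n: "n > 0" "lam \<le> real n" for n
  proof -
    have fin: "finite (K n)"
      by (rule finite_subset[of _ "{..nat \<lfloor>eta * real n\<rfloor>}"]) (auto simp: K_def le_nat_floor)
    have "P n (- good n) = P n (- good n \<inter> set_pmf (erdos_renyi n (lam / real n)))"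
      by (simp add: P_def measure_Int_set_pmf)
    also have "\<dots> \<le> P n (\<Union>k\<in>K n. B n k)"
      unfolding P_def
    proof (intro measure_pmf.finite_measure_mono subsetI)
      fix G assume G: "G \<in> - good n \<inter> set_pmf (erdos_renyi n (lam / real n))"
      then obtain S where S: "S \<subseteq> {1..n}" "real (card S) \<le> eta * real n"
          and dense: "real (edges_inside G S) > (1 + eps) * real (card S)"
        by (auto simp: good_def not_le)
      \<comment> \<open>The empty set violates nothing, since edges are nonempty; this excludes \<open>k = 0\<close>.\<close>
      have "S \<noteq> {}"
      proof
        assume "S = {}"
        moreover have "{} \<notin> G"
          using G set_pmf_erdos_renyi_subset[of G n] by (auto simp: potential_edges_def)
        then have "edges_inside G {} = 0" by (auto simp: edges_inside_def)
        ultimately show False using dense by simp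
      qed
      then have "card S > 0" using S(1) finite_subset card_gt_0_iff by blast
      moreover have "m (card S) \<le> edges_inside G S"
        using dense unfolding m_def by linarith
      ultimately show "G \<in> (\<Union>k\<in>K n. B n k)" using S by (auto simp: K_def B_def)
    qed auto
    also have "\<dots> \<le> (\<Sum>k\<in>K n. P n (B n k))"
      unfolding P_def by (intro measure_UNION_le fin) auto
    also have "\<dots> \<le> s n"
      unfolding s_def
    proof (rule sum_mono)
      fix k assume k: "k \<in> K n"
      have "exp 1 * lam * (real k / real n) \<le> exp 1 * lam * eta"
        using k n assms by (intro mult_left_mono) (auto simp: K_def field_simps)
      with lameta have small: "exp 1 * lam * (real k / real n) \<le> 1" by linarith
      have "P n (B n k) \<le> real (n choose k) * (real (k\<^sup>2 choose m k) * (lam / real n) ^ m k)"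
        unfolding P_def B_def using n assms by (intro prob_exists_dense_set_le) auto
      also have "\<dots> \<le> (C * (real k / real n) powr eps) ^ k"
        unfolding C_def using assms k n small
        by (intro dense_set_count_le) (auto simp: K_def m_def real_nat_ceiling_ge)
      finally show "P n (B n k) \<le> (C * (real k / real n) powr eps) ^ k" .
    qed
    finally show ?thesis .
  qed
  have compl: "P n (good n) = 1 - P n (- good n)" for n
    unfolding P_def using measure_pmf.prob_compl[of "good n"] by (simp add: Compl_eq_Diff_UNIV)
  have "s \<longlonglongrightarrow> 0"
    unfolding s_def K_def using C assms Ceta by (intro truncated_power_sum_tendsto_0) auto
  then have "(\<lambda>n. 1 - s n) \<longlonglongrightarrow> 1"
    using tendsto_diff[OF tendsto_const[of 1]] by fastforce
  moreover have "\<forall>\<^sub>F n in sequentially. 1 - s n \<le> P n (good n)"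
    using eventually_ge_at_top[of "max 1 (nat \<lceil>lam\<rceil>)"]
    by eventually_elim (use bad_le compl in \<open>fastforce simp: nat_le_iff ceiling_le_iff\<close>)
  moreover have "\<forall>\<^sub>F n in sequentially. P n (good n) \<le> 1"
    by (simp add: P_def)
  ultimately have "(\<lambda>n. P n (good n)) \<longlonglongrightarrow> 1"
    by (rule tendsto_sandwich[OF _ _ _ tendsto_const, rotated 2])
  then show ?thesis
    using eta unfolding P_def good_def by blast
qed

end
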